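(* Let $C\subseteq\mathbb{Z}_2^n$ be an $11$-cap of dimension $7$ with a basis $B$ of type $5\text{-}5\text{-}5$, and write $D=C\setminus B=\{x_1,x_2,x_3\}$ and $B_{ij}=B_{x_i}\cap B_{x_j}$. Then $|B_{ij}|=2$ for at most one pair $\{i,j\}\subseteq\{1,2,3\}$.
   Context: Work in $\mathbb{Z}_2^n$. An affine combination of a set is a sum of an odd number of its distinct elements; $\operatorname{aff}(S)$ is the set of all affine combinations of elements of $S$, and the dimension of $S$ is the dimension of the affine flat $\operatorname{aff}(S)$. A basis for $S$ is a subset $B\subseteq S$ that is affinely independent (no element is an affine combination of the others) with $\operatorname{aff}(B)=\operatorname{aff}(S)$; its dependent set is $D=S\setminus B$. For $x\in D$, $B_x$ is the unique subset of $B$ whose elements sum to $x$. A quad is a set of four distinct elements summing to $\mathbf{0}$; a cap is a quad-free subset; a $k$-cap is a cap with $k$ elements. The type of $B$ is the list of the numbers $|B_x|$, $x\in D$, in nonincreasing order, separated by hyphens. *)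

theory Defs
  imports "HOL-Analysis.Cartesian_Space" "HOL-Library.Z2" "HOL-Library.Multiset"
begin

definition aff :: "(bit ^ 'n) set \<Rightarrow> (bit ^ 'n) set" where
  "aff S = {\<Sum>T | T. T \<subseteq> S \<and> finite T \<and> odd (card T)}"

text \<open>The dimension of a flat is the linear dimension of its direction space. The empty set
  gets dimension 0 here.\<close>

definition flat_dim :: "(bit ^ 'n) set \<Rightarrow> nat" where
  "flat_dim F = vec.dim {u - v | u v. u \<in> F \<and> v \<in> F}"

definition set_dim :: "(bit ^ 'n) set \<Rightarrow> nat" where
  "set_dim S = flat_dim (aff S)"

definition affinely_independent :: "(bit ^ 'n) set \<Rightarrow> bool" where
  "affinely_independent B \<longleftrightarrow> (\<forall>b\<in>B. b \<notin> aff (B - {b}))"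

definition basis_for :: "(bit ^ 'n) set \<Rightarrow> (bit ^ 'n) set \<Rightarrow> bool" where
  "basis_for B S \<longleftrightarrow> B \<subseteq> S \<and> affinely_independent B \<and> aff B = aff S"

text \<open>The set \<open>B\<^sub>x\<close>. The cardinality is required to be odd because \<open>x\<close> is an affine
  combination of its elements; without this the set need not be unique, since an affinely
  independent \<open>B\<close> may have a nonempty (odd) subset with sum \<open>0\<close>, e.g. when \<open>0 \<in> B\<close>.\<close>

definition support_in :: "(bit ^ 'n) set \<Rightarrow> bit ^ 'n \<Rightarrow> (bit ^ 'n) set" where
  "support_in B x = (THE T. T \<subseteq> B \<and> finite T \<and> odd (card T) \<and> \<Sum>T = x)"

definition quad :: "(bit ^ 'n) set \<Rightarrow> bool" where
  "quad Q \<longleftrightarrow> card Q = 4 \<and> \<Sum>Q = 0"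

definition cap :: "(bit ^ 'n) set \<Rightarrow> bool" where
  "cap C \<longleftrightarrow> (\<forall>Q. Q \<subseteq> C \<longrightarrow> \<not> quad Q)"

definition k_cap :: "nat \<Rightarrow> (bit ^ 'n) set \<Rightarrow> bool" where
  "k_cap k C \<longleftrightarrow> cap C \<and> finite C \<and> card C = k"

definition basis_type :: "(bit ^ 'n) set \<Rightarrow> (bit ^ 'n) set \<Rightarrow> nat list" where
  "basis_type S B =
     rev (sorted_list_of_multiset {# card (support_in B x). x \<in># mset_set (S - B) #})"

lemma bit_vec_add_self: "x + x = (0 :: bit ^ 'n)"
  by (simp add: vec_eq_iff)

lemma sum_sym_diff:
  fixes S T :: "(bit ^ 'n) set"
  assumes "finite S" "finite T"
  shows "\<Sum>(S - T \<union> (T - S)) = \<Sum>S + \<Sum>T"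
proof -
  have "\<Sum>S = \<Sum>(S - T) + \<Sum>(S \<inter> T)"
    using sum.Int_Diff[OF assms(1), of "\<lambda>x. x" T] by (simp add: add.commute)
  moreover have "\<Sum>T = \<Sum>(T - S) + \<Sum>(S \<inter> T)"
    using sum.Int_Diff[OF assms(2), of "\<lambda>x. x" S] by (simp add: add.commute Int_commute)
  moreover have "\<Sum>(S - T \<union> (T - S)) = \<Sum>(S - T) + \<Sum>(T - S)"
    by (rule sum.union_disjoint) (use assms in auto)
  moreover have "(\<Sum>(S - T) + \<Sum>(S \<inter> T)) + (\<Sum>(T - S) + \<Sum>(S \<inter> T))
      = \<Sum>(S - T) + \<Sum>(T - S) + (\<Sum>(S \<inter> T) + \<Sum>(S \<inter> T))"
    by (simp only: ac_simps)
  ultimately show ?thesis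
    by (simp add: bit_vec_add_self)
qed

lemma support_unique:
  fixes B :: "(bit ^ 'n) set"
  assumes ind: "affinely_independent B"
    and S: "S \<subseteq> B" "finite S" "odd (card S)"
    and T: "T \<subseteq> B" "finite T" "odd (card T)"
    and eq: "\<Sum>S = \<Sum>T"
  shows "S = T"
proof (rule ccontr)
  assume "S \<noteq> T"
  define U where "U = S - T \<union> (T - S)"
  have fin: "finite U" and sub: "U \<subseteq> B" and "U \<noteq> {}"
    using S T \<open>S \<noteq> T\<close> by (auto simp: U_def)
  then obtain b where b: "b \<in> U" by blast
  have U0: "\<Sum>U = 0"
    using sum_sym_diff[OF S(2) T(2)] eq by (simp add: U_def bit_vec_add_self)
  have "card U = card (S - T) + card (T - S)"
    unfolding U_def by (rule card_Un_disjoint) (use S T in auto)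
  moreover have "card S = card (S - T) + card (S \<inter> T)"
    using card_Int_Diff[OF S(2), of T] by simp
  moreover have "card T = card (T - S) + card (S \<inter> T)"
    using card_Int_Diff[OF T(2), of S] by (simp add: Int_commute)
  ultimately have "even (card U)"
    using S(3) T(3) by presburger
  moreover have "card U = Suc (card (U - {b}))"
    using card.remove[OF fin b] .
  ultimately have odd: "odd (card (U - {b}))" by simp
  have "b + \<Sum>(U - {b}) = 0"
    using U0 sum.remove[OF fin b, of "\<lambda>x. x"] by simp
  then have "\<Sum>(U - {b}) = b"
    using bit_vec_add_self[of b] add_left_cancel[of b "\<Sum>(U - {b})" b] by simp
  then have "b \<in> aff (B - {b})"
    unfolding aff_def mem_Collect_eq
    by (intro exI[of _ "U - {b}"] conjI) (use odd fin sub in auto)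
  with ind b sub show False
    by (auto simp: affinely_independent_def)
qed

lemma support_in:
  assumes "affinely_independent B" "x \<in> aff B"
  shows "support_in B x \<subseteq> B \<and> finite (support_in B x) \<and> odd (card (support_in B x)) \<and>
    \<Sum>(support_in B x) = x"
proof -
  have "\<exists>!T. T \<subseteq> B \<and> finite T \<and> odd (card T) \<and> \<Sum>T = x"
    using assms(2) support_unique[OF assms(1)] unfolding aff_def by blast
  then show ?thesis
    unfolding support_in_def by (rule theI')
qed

end

theory Submission
  imports Defs
begin

text \<open>Two supports \<open>Q\<close>, \<open>R\<close> that each meet \<open>P\<close> in two points both contain the three points of
  \<open>B - P\<close>, because \<open>B\<close> has only eight points. Hence their symmetric difference \<open>E\<close> lies in \<open>P\<close>
  and has 0, 2 or 4 elements. If \<open>E\<close> is empty, two dependent points coincide; if \<open>E\<close> has two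
  elements, these form a quad with two dependent points; if \<open>E\<close> has four, the remaining element
  of \<open>P\<close> forms a quad with all three dependent points.\<close>

lemma cap_no_quad:
  assumes "cap C" "a \<in> C" "b \<in> C" "c \<in> C" "d \<in> C"
    and "distinct [a, b, c, d]"
  shows "a + b + c + d \<noteq> 0"
proof
  assume "a + b + c + d = 0"
  with assms(6) have "quad {a, b, c, d}"
    by (simp add: quad_def add.assoc)
  with assms(1-5) show False
    by (auto simp: cap_def)
qed

lemma sym_diff_if_both_meet_in_two:
  assumes fin: "finite B" and card: "card B = 8"
    and sub: "P \<subseteq> B" "Q \<subseteq> B" "R \<subseteq> B"
    and five: "card P = 5" "card Q = 5" "card R = 5"
    and two: "card (P \<inter> Q) = 2" "card (P \<inter> R) = 2"
  defines "E \<equiv> Q - R \<union> (R - Q)"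
  shows "E \<subseteq> P" and "card E \<in> {0, 2, 4}"
proof -
  have finPQR: "finite P" "finite Q" "finite R"
    using fin sub finite_subset by blast+
  \<comment> \<open>By inclusion-exclusion the union has 5 + 5 - 2 = 8 points, which is the size of
    \<open>B\<close>.\<close>
  have cover: "P \<union> Z = B" if "Z \<subseteq> B" "finite Z" "card Z = 5" "card (P \<inter> Z) = 2" for Z
  proof (rule card_subset_eq[OF fin])
    show "P \<union> Z \<subseteq> B" using that sub by blast
    show "card (P \<union> Z) = card B"
      using card_Un_Int[OF finPQR(1) that(2)] that five card by simp
  qed
  have PQ: "P \<union> Q = B" and PR: "P \<union> R = B"
    using cover sub five two finPQR by auto
  then show "E \<subseteq> P"
    unfolding E_def by blast
  have "card (B - P) = 3"
    using card_Diff_subset[OF finPQR(1) sub(1)] card five by simp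
  moreover have "B - P \<subseteq> Q \<inter> R"
    using PQ PR by blast
  ultimately have "3 \<le> card (Q \<inter> R)"
    using card_mono[of "Q \<inter> R" "B - P"] finPQR by simp
  moreover have "card E = card (Q - R) + card (R - Q)"
    unfolding E_def by (rule card_Un_disjoint) (use finPQR in auto)
  moreover have "card Q = card (Q \<inter> R) + card (Q - R)"
    using card_Int_Diff[OF finPQR(2)] .
  moreover have "card R = card (Q \<inter> R) + card (R - Q)"
    using card_Int_Diff[OF finPQR(3), of Q] by (simp add: Int_commute)
  \<comment> \<open>The two supports have 10 points counted with multiplicity, and each common point
    accounts for two of them. With at least three common points, only an even number up to 4 remains
    for \<open>E\<close>.\<close>
  ultimately have "card E + 2 * card (Q \<inter> R) = 10" "3 \<le> card (Q \<inter> R)"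
    using five by linarith+
  then have "card E = 0 \<or> card E = 2 \<or> card E = 4"
    by presburger
  then show "card E \<in> {0, 2, 4}"
    by auto
qed

text \<open>Two distinct pairs out of three indices share an index. Here \<open>P\<close> is the
  support at the shared index, so the conclusion excludes a second pair.\<close>

lemma cap_no_two_pairs:
  fixes C B :: "(bit ^ 'n) set"
  assumes cap: "cap C" and BC: "B \<subseteq> C" and fin: "finite B" and card: "card B = 8"
    and mem: "x \<in> C - B" "y \<in> C - B" "z \<in> C - B" and dist: "distinct [x, y, z]"
    and sub: "P \<subseteq> B" "Q \<subseteq> B" "R \<subseteq> B"
    and five: "card P = 5" "card Q = 5" "card R = 5"
    and sums: "\<Sum>P = x" "\<Sum>Q = y" "\<Sum>R = z"
    and two: "card (P \<inter> Q) = 2"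
  shows "card (P \<inter> R) \<noteq> 2"
proof
  assume two': "card (P \<inter> R) = 2"
  have finPQR: "finite P" "finite Q" "finite R"
    using fin sub finite_subset by blast+
  define E where "E = Q - R \<union> (R - Q)"
  have EP: "E \<subseteq> P" and cardE: "card E \<in> {0, 2, 4}"
    unfolding E_def
    using sym_diff_if_both_meet_in_two[OF fin card sub five two two'] by auto
  have finE: "finite E"
    using EP finPQR finite_subset by blast
  \<comment> \<open>Points common to \<open>Q\<close> and \<open>R\<close> cancel, since every
    vector is its own negative.\<close>
  have sumE: "\<Sum>E = y + z"
    unfolding E_def using sum_sym_diff[OF finPQR(2,3)] sums by simp
  consider "card E = 0" | "card E = 2" | "card E = 4"
    using cardE by auto
  then show False
  proof cases
    case 1
    then have "Q = R"
      using finE by (auto simp: E_def)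
    with sums dist show False by simp
  next
    case 2
    then obtain a b where E: "E = {a, b}" and ab: "a \<noteq> b"
      by (meson card_2_iff)
    then have "a + b = y + z"
      using sumE by simp
    then have "a + b + y + z = 0"
      using bit_vec_add_self[of "y + z"] by (simp add: add.assoc)
    moreover have "a \<in> B" "b \<in> B"
      using E EP sub by auto
    \<comment> \<open>Distinctness across the two pairs holds because \<open>a\<close> and
      \<open>b\<close> lie in \<open>B\<close>, while \<open>y\<close> and \<open>z\<close> lie
      outside it.\<close>
    then have "a \<in> C" "b \<in> C" "distinct [a, b, y, z]"
      using BC mem dist ab by auto
    ultimately show False
      using cap_no_quad[OF cap] mem by blast
  next
    case 3
    then have "card (P - E) = 1"
      using card_Diff_subset[OF finE EP] five by simp
    then obtain p where p: "P - E = {p}"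
      by (meson card_1_singletonE)
    have "\<Sum>P = \<Sum>(P - E) + \<Sum>E"
      using sum.subset_diff[OF EP finPQR(1)] .
    then have "x = p + (y + z)"
      using p sums sumE by simp
    \<comment> \<open>Substituting for \<open>x\<close> makes \<open>p\<close> and
      \<open>y + z\<close> each occur twice, and a doubled vector vanishes.\<close>
    then have "p + x + y + z = (p + p) + ((y + z) + (y + z))"
      by (simp only: ac_simps)
    then have "p + x + y + z = 0"
      by (simp only: bit_vec_add_self add_0)
    moreover have "p \<in> B"
      using p sub by blast
    then have "p \<in> C" "distinct [p, x, y, z]"
      using BC mem dist by auto
    ultimately show False
      using cap_no_quad[OF cap] mem by blast
  qed
qed

theorem theorem6p4:
  fixes C B :: "(bit ^ 'n) set" and x :: "nat \<Rightarrow> bit ^ 'n"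
  assumes "k_cap 11 C"
    and "set_dim C = 7"
    and "basis_for B C"
    and "basis_type C B = [5, 5, 5]"
    and "bij_betw x {1, 2, 3} (C - B)"
  shows "card {{i, j} | i j. i \<in> {1, 2, 3} \<and> j \<in> {1, 2, 3} \<and> i \<noteq> j \<and>
           card (support_in B (x i) \<inter> support_in B (x j)) = 2} \<le> 1"
proof -
  let ?S = "\<lambda>i. support_in B (x i)"
  have cap: "cap C" and finC: "finite C" and cardC: "card C = 11"
    using assms(1) by (auto simp: k_cap_def)
  have BC: "B \<subseteq> C" and ind: "affinely_independent B" and aff: "aff B = aff C"
    using assms(3) by (auto simp: basis_for_def)
  have finB: "finite B"
    using BC finC finite_subset by blast
  have "card (C - B) = 3"
    using bij_betw_same_card[OF assms(5)] by simp
  \<comment> \<open>\<open>x\<close> enumerates three dependent points, which leaves 8 of the 11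
    points for \<open>B\<close>.\<close>
  then have cardB: "card B = 8"
    using card_Diff_subset[OF finB BC] card_mono[OF finC BC] cardC by simp
  have memD: "x i \<in> C - B" if "i \<in> {1, 2, 3}" for i
    using assms(5) that by (auto simp: bij_betw_def)
  have inj: "x i \<noteq> x j" if "i \<in> {1, 2, 3}" "j \<in> {1, 2, 3}" "i \<noteq> j" for i j
    using assms(5) that unfolding bij_betw_def inj_on_def by blast
  \<comment> \<open>Passing to multisets discards the sorting and \<open>rev\<close>, so the type
    list yields the set of all support sizes.\<close>
  have "mset (basis_type C B) = {# card (support_in B v). v \<in># mset_set (C - B) #}"
    unfolding basis_type_def by simp
  then have "set_mset {# card (support_in B v). v \<in># mset_set (C - B) #} = {5}"
    using assms(4) by (metis set_mset_mset list.set insert_absorb2)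
  then have five: "card (support_in B v) = 5" if "v \<in> C - B" for v
    using that finC by auto
  \<comment> \<open>A single point is an odd sum of itself. Hence dependent points lie in
    \<open>aff B\<close>, where the description in \<open>support_in\<close> is known to denote a
    support.\<close>
  have "v \<in> aff B" if "v \<in> C" for v
    unfolding aff using that by (auto simp: aff_def intro!: exI[of _ "{v}"])
  then have supp: "?S i \<subseteq> B" "\<Sum>(?S i) = x i" "card (?S i) = 5" if "i \<in> {1, 2, 3}" for i
    using support_in[OF ind] memD[OF that] five by blast+
  have no_two: "card (?S i \<inter> ?S k) \<noteq> 2"
    if "card (?S i \<inter> ?S j) = 2" "{i, j, k} \<subseteq> {1, 2, 3}" "distinct [i, j, k]" for i j k
  proof -
    have idx: "i \<in> {1, 2, 3}" "j \<in> {1, 2, 3}" "k \<in> {1, 2, 3}"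
      using that(2) by auto
    have "distinct [x i, x j, x k]"
      using that(3) inj idx by simp
    from cap_no_two_pairs[OF cap BC finB cardB memD[OF idx(1)] memD[OF idx(2)] memD[OF idx(3)]
        this supp(1)[OF idx(1)] supp(1)[OF idx(2)] supp(1)[OF idx(3)]
        supp(3)[OF idx(1)] supp(3)[OF idx(2)] supp(3)[OF idx(3)]
        supp(2)[OF idx(1)] supp(2)[OF idx(2)] supp(2)[OF idx(3)] that(1)]
    show ?thesis .
  qed
  let ?N = "{{i, j} | i j. i \<in> {1, 2, 3} \<and> j \<in> {1, 2, 3} \<and> i \<noteq> j \<and> card (?S i \<inter> ?S j) = 2}"
  have "?N \<subseteq> Pow {1, 2, 3}"
    by blast
  then have "finite ?N"
    by (rule finite_subset) simp
  moreover have "p = q" if "p \<in> ?N" "q \<in> ?N" for p q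
  proof (rule ccontr)
    assume "p \<noteq> q"
    from that(1) obtain i j where ij: "p = {i, j}" "i \<in> {1, 2, 3}" "j \<in> {1, 2, 3}" "i \<noteq> j"
      "card (?S i \<inter> ?S j) = 2" by blast
    from that(2) obtain k l where kl: "q = {k, l}" "k \<in> {1, 2, 3}" "l \<in> {1, 2, 3}" "k \<noteq> l"
      "card (?S k \<inter> ?S l) = 2" by blast
    \<comment> \<open>Distinct two-element subsets of a three-element set share exactly one index.
      The cases record its position in each pair, and \<open>no_two\<close> is then applied with the
      shared index first.\<close>
    have "i = k \<and> j \<noteq> l \<or> i = l \<and> j \<noteq> k \<or> j = k \<and> i \<noteq> l \<or> j = l \<and> i \<noteq> k"
      using ij(1-4) kl(1-4) \<open>p \<noteq> q\<close> by auto
    then show False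
    proof (elim disjE conjE)
      assume "i = k" "j \<noteq> l"
      with ij kl no_two[of i j l] show False by auto
    next
      assume "i = l" "j \<noteq> k"
      with ij kl no_two[of i j k] show False by (auto simp: Int_commute)
    next
      assume "j = k" "i \<noteq> l"
      with ij kl no_two[of j i l] show False by (auto simp: Int_commute)
    next
      assume "j = l" "i \<noteq> k"
      with ij kl no_two[of j i k] show False by (auto simp: Int_commute)
    qed
  qed
  ultimately show ?thesis
    by (simp only: One_nat_def card_le_Suc0_iff_eq) blast
qed

end
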